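(* Let $U$ be a unitary operator on $\mathbb{C}^N$ with $N$ distinct eigenvalues and let $k\ge 1$. Then the following hold. (1) If $N<2k$, then $\Omega_k(U)=\emptyset$. (2) If $N=2k$, then $\Omega_k(U)$ is empty if the line segments $[\lambda_j,\lambda_{j+k}]$ do not intersect in a common point, and, otherwise, it is the singleton set given by the intersection point of these line segments. (3) If $2k<N<3k-2$, then $\Omega_k(U)$ can be either empty or nonempty (depending on $U$). For any unitary $U$ on $\mathbb{C}^N$, whether or not the eigenvalues are distinct, we have: (4) If $N\ge 3k-2$, then $\Omega_k(U)$ is always nonempty.
   Context: For an operator $T$ on $\mathbb{C}^N$ with eigenvalues $\lambda_1,\dots,\lambda_N$ (listed with multiplicity) and an integer $k$ with $1\le k\le N$, $\Omega_k(T)=\bigcap_{S}\operatorname{conv}\{\lambda_j: j\in S\}$, where $S$ runs over all subsets of $\{1,\dots,N\}$ with exactly $N-k+1$ elements and $\operatorname{conv}$ denotes the convex hull in $\mathbb{C}$. The eigenvalues $\lambda_1,\dots,\lambda_N$ of the unitary $U$ are numbered in counterclockwise order around the unit circle, with indices extended cyclically modulo $N$; $[\lambda_i,\lambda_j]$ denotes the line segment joining $\lambda_i$ and $\lambda_j$.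
   Formalization: Part (1) excludes N = k = 1, where Ω_1(U) = {λ_1} is nonempty; the singleton claim in part (2) requires k ≠ 1, since for k = 1, N = 2 both segments coincide and Ω_1(U) is the whole segment [λ_1, λ_2]. *)

theory Defs
  imports
    "HOL-Analysis.Analysis"
    "HOL-Combinatorics.Permutations"
    "Jordan_Normal_Form.Schur_Decomposition"
    "Jordan_Normal_Form.Spectral_Radius"
begin

definition unitary_mat :: "complex mat \<Rightarrow> bool" where
  "unitary_mat U \<longleftrightarrow>
     mat_adjoint U * U = 1\<^sub>m (dim_row U) \<and> U * mat_adjoint U = 1\<^sub>m (dim_row U)"

text \<open>
  Eigenvalues are indexed by \<open>1, \<dots>, N\<close>; the values of \<open>ev\<close> outside this
  range are not constrained.
\<close>

definition eigenvalue_listing :: "complex mat \<Rightarrow> (nat \<Rightarrow> complex) \<Rightarrow> bool" where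
  "eigenvalue_listing T ev \<longleftrightarrow> char_poly T = (\<Prod>j=1..dim_row T. [:- ev j, 1:])"

text \<open>
  The subsets have \<open>N + 1 - k\<close> elements. For \<open>k > N\<close>, outside the range for which
  the notion is introduced, truncated subtraction leaves only \<open>S = {}\<close>, so that the
  intersection is empty.
\<close>

definition Omega_of_listing :: "nat \<Rightarrow> nat \<Rightarrow> (nat \<Rightarrow> complex) \<Rightarrow> complex set" where
  "Omega_of_listing N k ev =
     (\<Inter>S \<in> {S. S \<subseteq> {1..N} \<and> card S = N + 1 - k}. convex hull (ev ` S))"

text \<open>
  The choice of the listing is immaterial: see \<open>Omega_eq\<close> below.
\<close>

definition Omega :: "nat \<Rightarrow> complex mat \<Rightarrow> complex set" where
  "Omega k T = Omega_of_listing (dim_row T) k (SOME ev. eigenvalue_listing T ev)"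

text \<open>
  Counterclockwise numbering around the unit circle: the arguments increase weakly and
  the numbering goes around at most once.
\<close>

definition counterclockwise :: "nat \<Rightarrow> (nat \<Rightarrow> complex) \<Rightarrow> bool" where
  "counterclockwise N ev \<longleftrightarrow>
     (\<exists>\<theta> :: nat \<Rightarrow> real.
        (\<forall>j\<in>{1..N}. ev j = cis (\<theta> j)) \<and> mono_on {1..N} \<theta> \<and> \<theta> N < \<theta> 1 + 2 * pi)"

lemma eigenvalue_listing_exists:
  assumes "T \<in> carrier_mat N N"
  shows "\<exists>ev. eigenvalue_listing T ev"
proof -
  from char_poly_factorized[OF assms] obtain as where
    as: "char_poly T = (\<Prod>a\<leftarrow>as. [:- a, 1:])" "length as = N" by auto
  have "(\<Prod>a\<leftarrow>as. [:- a, 1:]) = (\<Prod>i = 0..<N. [:- (as ! i), 1:])"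
    using as(2) by (subst prod.list_conv_set_nth) simp
  also have "\<dots> = (\<Prod>j = 1..N. [:- (as ! (j - 1)), 1:])"
    by (rule prod.reindex_bij_witness[where i = "\<lambda>j. j - 1" and j = Suc]) auto
  finally have "eigenvalue_listing T (\<lambda>j. as ! (j - 1))"
    using as assms by (simp add: eigenvalue_listing_def)
  then show ?thesis by (rule exI[where P = "eigenvalue_listing T"])
qed

lemma proots_prod_linear:
  fixes ev :: "nat \<Rightarrow> complex"
  assumes "finite A"
  shows "proots (\<Prod>j\<in>A. [:- ev j, 1:]) = image_mset ev (mset_set A)"
  using assms
proof (induction A rule: finite_induct)
  case (insert x F)
  have "(\<Prod>j\<in>F. [:- ev j, 1:]) \<noteq> 0" using insert by auto
  then show ?case using insert by (simp add: proots_mult del: mult_pCons_left)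
qed simp

lemma Omega_of_listing_cong:
  assumes "eigenvalue_listing T ev" "eigenvalue_listing T ev'" "dim_row T = N"
  shows "Omega_of_listing N k ev \<subseteq> Omega_of_listing N k ev'"
proof -
  have "image_mset ev (mset_set {1..N}) = image_mset ev' (mset_set {1..N})"
    using assms proots_prod_linear[of "{1..N}" ev] proots_prod_linear[of "{1..N}" ev']
    by (simp add: eigenvalue_listing_def)
  then obtain p where p: "p permutes {1..N}" "\<forall>x\<in>{1..N}. ev' x = ev (p x)"
    using image_mset_eq_implies_permutes[of "{1..N}" ev' ev] by auto
  show ?thesis
    unfolding Omega_of_listing_def
  proof (rule INT_greatest)
    fix S assume S: "S \<in> {S. S \<subseteq> {1..N} \<and> card S = N + 1 - k}"
    have "p ` S \<subseteq> {1..N}" using S p(1) permutes_image by blast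
    moreover have "card (p ` S) = card S"
      by (meson card_image inj_on_subset p(1) permutes_inj subset_UNIV)
    moreover have "ev' ` S = ev ` p ` S" using S p(2) by (force simp: image_image)
    ultimately show "(\<Inter>S \<in> {S. S \<subseteq> {1..N} \<and> card S = N + 1 - k}. convex hull (ev ` S))
        \<subseteq> convex hull (ev' ` S)"
      using S by auto
  qed
qed

lemma Omega_eq:
  assumes "T \<in> carrier_mat N N" "eigenvalue_listing T ev"
  shows "Omega k T = Omega_of_listing N k ev"
proof -
  have "eigenvalue_listing T (SOME ev'. eigenvalue_listing T ev')"
    using assms(2) someI[where P = "eigenvalue_listing T" and x = ev] by simp
  then show ?thesis
    using assms Omega_of_listing_cong unfolding Omega_def by (metis carrier_matD(1) subset_antisym)
qed

end

theory Submission
  imports Defs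
begin

text \<open>
  A closed halfplane containing a point \<open>p\<close> of \<open>\<Omega>\<^sub>k\<close> contains at least \<open>k\<close> eigenvalues. A line
  through \<open>p\<close> avoiding the eigenvalues then gives \<open>2 k \<le> N\<close>, and if \<open>p\<close> itself is an eigenvalue,
  the tangent at \<open>p\<close> gives \<open>k \<le> 1\<close>. For \<open>N = 2 k\<close>, any \<open>k + 1\<close> eigenvalues include the ends of some
  segment \<open>[\<lambda>\<^sub>j, \<lambda>\<^sub>j\<^sub>+\<^sub>k]\<close>, and each segment is the intersection of the hulls of the two arcs it cuts off,
  so \<open>\<Omega>\<^sub>k\<close> is the intersection of the segments. Antipodal pairs and three tight clusters give the two
  examples for part (3). Part (4) is Helly's theorem in the plane: three sets of indices, each missing at most
  \<open>k - 1 < N / 3\<close> of them, have a common element.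
\<close>

unbundle no vec_syntax

section \<open>Unitary matrices and eigenvalue listings\<close>

lemma mat_adjoint_carrier [simp]:
  "A \<in> carrier_mat n m \<Longrightarrow> mat_adjoint A \<in> carrier_mat m n"
  by (auto simp: mat_adjoint_def)

lemma index_mat_adjoint:
  fixes A :: "complex mat"
  assumes "A \<in> carrier_mat n m" "i < m" "j < n"
  shows "mat_adjoint A $$ (i, j) = cnj (A $$ (j, i))"
  using assms by (simp add: mat_adjoint_def mat_of_rows_index)

lemma mat_adjoint_cscalar_prod:
  fixes A :: "complex mat"
  assumes A: "A \<in> carrier_mat n n" and v: "v \<in> carrier_vec n" and w: "w \<in> carrier_vec n"
  shows "(mat_adjoint A *\<^sub>v w) \<bullet>c v = w \<bullet>c (A *\<^sub>v v)"
proof -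
  have A': "mat_adjoint A \<in> carrier_mat n n"
    using A by simp
  have L: "(mat_adjoint A *\<^sub>v w) $ i = (\<Sum>j = 0..<n. cnj (A $$ (j, i)) * w $ j)" if "i < n" for i
    using that A' w by (auto simp: scalar_prod_def index_mat_adjoint[OF A] intro!: sum.cong)
  have R: "(A *\<^sub>v v) $ j = (\<Sum>i = 0..<n. A $$ (j, i) * v $ i)" if "j < n" for j
    using that A v by (auto simp: scalar_prod_def intro!: sum.cong)
  have "(mat_adjoint A *\<^sub>v w) \<bullet>c v = (\<Sum>i = 0..<n. (mat_adjoint A *\<^sub>v w) $ i * cnj (v $ i))"
    using v by (simp add: scalar_prod_def)
  also have "\<dots> = (\<Sum>i = 0..<n. \<Sum>j = 0..<n. cnj (A $$ (j, i)) * w $ j * cnj (v $ i))"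
    by (intro sum.cong refl) (simp add: L sum_distrib_right)
  also have "\<dots> = (\<Sum>j = 0..<n. \<Sum>i = 0..<n. cnj (A $$ (j, i)) * w $ j * cnj (v $ i))"
    by (rule sum.swap)
  also have "\<dots> = (\<Sum>j = 0..<n. w $ j * cnj ((A *\<^sub>v v) $ j))"
    by (intro sum.cong refl) (simp add: R sum_distrib_left mult_ac)
  also have "\<dots> = w \<bullet>c (A *\<^sub>v v)"
    using A v by (simp add: scalar_prod_def)
  finally show ?thesis .
qed

text \<open>The adjoint inverts \<open>U\<close>, so an eigenvector \<open>v\<close> and its image
  \<open>U v\<close> have the same scalar square; the latter is \<open>l * cnj l\<close> times the
  former, which is nonzero.\<close>

lemma unitary_eigenvalue_norm:
  assumes U: "U \<in> carrier_mat N N" "unitary_mat U" and ev: "eigenvalue U l"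
  shows "norm l = 1"
proof -
  obtain v where v: "v \<in> carrier_vec N" "v \<noteq> 0\<^sub>v N" "U *\<^sub>v v = l \<cdot>\<^sub>v v"
    using ev U(1) by (auto simp: eigenvalue_def eigenvector_def)
  have A': "mat_adjoint U \<in> carrier_mat N N"
    using U(1) by simp
  have "mat_adjoint U *\<^sub>v (U *\<^sub>v v) = (mat_adjoint U * U) *\<^sub>v v"
    using assoc_mult_mat_vec[OF A' U(1) v(1)] by simp
  also have "\<dots> = v"
    using U v(1) by (auto simp: unitary_mat_def)
  finally have "v \<bullet>c v = (U *\<^sub>v v) \<bullet>c (U *\<^sub>v v)"
    using mat_adjoint_cscalar_prod[OF U(1) v(1), of "U *\<^sub>v v"] U(1) v(1) by simp
  also have "\<dots> = (l * cnj l) * (v \<bullet>c v)"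
    using v by (simp add: conjugate_smult_vec)
  finally have "l * cnj l = 1"
    using v conjugate_square_eq_0_vec[OF v(1)] by auto
  then have "of_real ((norm l)\<^sup>2) = (1 :: complex)"
    by (simp only: complex_norm_square)
  then have "(norm l)\<^sup>2 = 1"
    by (metis of_real_eq_1_iff)
  then show ?thesis
    by (metis norm_ge_zero power2_eq_1_iff neg_0_le_iff_le not_one_le_zero)
qed

lemma spectrum_eigenvalue_listing:
  assumes "U \<in> carrier_mat N N" "eigenvalue_listing U ev"
  shows "spectrum U = ev ` {1..N}"
  using assms unfolding spectrum_root_char_poly[OF assms(1)]
  by (auto simp: eigenvalue_listing_def poly_prod)

lemma eigenvalue_listing_inj_on:
  assumes "U \<in> carrier_mat N N" "eigenvalue_listing U ev" "card (spectrum U) = N"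
  shows "inj_on ev {1..N}"
  using assms by (intro eq_card_imp_inj_on) (auto simp: spectrum_eigenvalue_listing)

lemma eigenvalue_listing_norm:
  assumes "U \<in> carrier_mat N N" "unitary_mat U" "eigenvalue_listing U ev" "j \<in> {1..N}"
  shows "norm (ev j) = 1"
proof -
  have "ev j \<in> spectrum U"
    using assms spectrum_eigenvalue_listing by blast
  then show ?thesis
    using assms unitary_eigenvalue_norm by (auto simp: spectrum_def)
qed

text \<open>A diagonal matrix realizes the listing, so examples can be built from points on the
  circle alone.\<close>

lemma unitary_with_listing:
  assumes ev: "\<And>j. j \<in> {1..N} \<Longrightarrow> norm (ev j) = 1" and inj: "inj_on ev {1..N}"
  shows "\<exists>U \<in> carrier_mat N N. unitary_mat U \<and> card (spectrum U) = N
           \<and> Omega k U = Omega_of_listing N k ev"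
proof -
  \<comment> \<open>Matrix indices start at 0, listings at 1.\<close>
  define U where "U = mat_diag N (\<lambda>i. ev (Suc i))"
  have U: "U \<in> carrier_mat N N"
    by (simp add: U_def)
  have "mat_adjoint U = mat_diag N (\<lambda>i. cnj (ev (Suc i)))"
    using U by (intro eq_matI) (auto simp: index_mat_adjoint[OF U] U_def mat_diag_def mat_adjoint_def mat_of_rows_index)
  moreover have "ev (Suc i) * cnj (ev (Suc i)) = 1" if "i < N" for i
    using ev[of "Suc i"] that by (simp add: complex_norm_square[symmetric])
  ultimately have "unitary_mat U"
    unfolding unitary_mat_def using U
    by (simp add: U_def mult.commute) (auto simp: mat_diag_def)
  have "diag_mat U = map (\<lambda>i. ev (Suc i)) [0..<N]"
    by (auto simp: U_def mat_diag_def diag_mat_def)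
  moreover have "upper_triangular U"
    by (auto simp: U_def mat_diag_def)
  ultimately have "char_poly U = (\<Prod>a\<leftarrow>map (\<lambda>i. ev (Suc i)) [0..<N]. [:- a, 1:])"
    using char_poly_upper_triangular[OF U] by simp
  also have "\<dots> = (\<Prod>i = 0..<N. [:- ev (Suc i), 1:])"
    by (simp add: prod.list_conv_set_nth)
  also have "\<dots> = (\<Prod>j = 1..N. [:- ev j, 1:])"
    by (rule prod.reindex_bij_witness[where i = "\<lambda>j. j - 1" and j = Suc]) auto
  finally have "eigenvalue_listing U ev"
    using U by (simp add: eigenvalue_listing_def)
  then show ?thesis
    using U \<open>unitary_mat U\<close> Omega_eq card_image[OF inj]
    by (intro bexI[of _ U]) (auto simp: spectrum_eigenvalue_listing)
qed

section \<open>Halfplanes and hulls\<close>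

lemma Omega_of_listing_mono:
  assumes "p \<in> Omega_of_listing N k ev" "S \<subseteq> {1..N}" "N + 1 - k \<le> card S"
  shows "p \<in> convex hull (ev ` S)"
proof -
  obtain T where T: "T \<subseteq> S" "card T = N + 1 - k"
    using obtain_subset_with_card_n[OF assms(3)] by metis
  then have "p \<in> convex hull (ev ` T)"
    using assms(1,2) by (auto simp: Omega_of_listing_def)
  then show ?thesis
    using T(1) hull_mono[of "ev ` T" "ev ` S" convex] by auto
qed

text \<open>With fewer than \<open>k\<close> eigenvalues in the closed halfplane, at least
  \<open>N + 1 - k\<close> would lie in the open complement, whose convexity would put
  \<open>p\<close> there too.\<close>

lemma Omega_halfplane_card:
  assumes "p \<in> Omega_of_listing N k ev" "k \<ge> 1"
  shows "k \<le> card {j \<in> {1..N}. inner a p \<le> inner a (ev j)}"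
proof (rule ccontr)
  let ?A = "{j \<in> {1..N}. inner a p \<le> inner a (ev j)}"
  assume "\<not> ?thesis"
  then have "N + 1 - k \<le> card ({1..N} - ?A)"
    by (subst card_Diff_subset) auto
  then have "p \<in> convex hull (ev ` ({1..N} - ?A))"
    using assms Omega_of_listing_mono[of p N k ev "{1..N} - ?A"] by auto
  also have "\<dots> \<subseteq> {z. inner a z < inner a p}"
    by (rule hull_minimal) (auto simp: convex_halfspace_lt)
  finally show False by simp
qed

lemma inner_unit_lt_1:
  fixes z w :: "'a :: real_inner"
  assumes "norm z = 1" "norm w = 1" "z \<noteq> w"
  shows "inner z w < 1"
proof -
  have "0 < (norm (z - w))\<^sup>2"
    using assms by simp
  also have "\<dots> = 2 - 2 * inner z w"
    using assms by (simp add: power2_norm_eq_inner inner_diff_left inner_diff_right inner_commute norm_eq_1)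
  finally show ?thesis by simp
qed

text \<open>Among the directions \<open>Complex 1 t\<close>, each nonzero \<open>v\<close> rules out
  at most one \<open>t\<close>.\<close>

lemma exists_direction_avoiding:
  fixes V :: "complex set"
  assumes "finite V" "0 \<notin> V"
  shows "\<exists>a. \<forall>v\<in>V. inner a v \<noteq> 0"
proof -
  have "finite {t. inner (Complex 1 t) v = 0}" if "v \<in> V" for v
  proof -
    have "v \<noteq> 0"
      using that assms(2) by auto
    \<comment> \<open>If \<open>Im v = 0\<close>, then \<open>Re v\<close> is nonzero and the left
      side is empty.\<close>
    then have "{t. inner (Complex 1 t) v = 0} \<subseteq> {- Re v / Im v}"
      by (cases "Im v = 0") (auto simp: inner_complex_def field_simps complex_eq_iff)
    then show ?thesis
      by (rule finite_subset) simp
  qed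
  then have "finite (\<Union>v\<in>V. {t. inner (Complex 1 t) v = 0})"
    using assms(1) by blast
  then obtain t where "t \<notin> (\<Union>v\<in>V. {t. inner (Complex 1 t) v = 0})"
    using ex_new_if_finite[OF infinite_UNIV_char_0] by blast
  then show ?thesis
    by blast
qed

lemma Omega_empty_if_lt_2k:
  assumes ev: "\<And>j. j \<in> {1..N} \<Longrightarrow> norm (ev j) = 1" and inj: "inj_on ev {1..N}"
    and "k \<ge> 1" "N < 2 * k" "\<not> (N = 1 \<and> k = 1)"
  shows "Omega_of_listing N k ev = {}"
proof (rule ccontr)
  assume "Omega_of_listing N k ev \<noteq> {}"
  then obtain p where p: "p \<in> Omega_of_listing N k ev"
    by blast
  note half = Omega_halfplane_card[OF p \<open>k \<ge> 1\<close>]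
  show False
  proof (cases "p \<in> ev ` {1..N}")
    case True
    then obtain i where i: "i \<in> {1..N}" "p = ev i"
      by blast
    \<comment> \<open>The halfplane beyond the tangent at \<open>p\<close> meets the unit circle
      only in \<open>p\<close>.\<close>
    have "j = i" if "j \<in> {1..N}" "inner p p \<le> inner p (ev j)" for j
    proof (rule ccontr)
      assume "j \<noteq> i"
      then have "ev i \<noteq> ev j"
        using inj_onD[OF inj _ i(1) that(1)] by blast
      then show False
        using inner_unit_lt_1[OF ev[OF i(1)] ev[OF that(1)]] that(2) i(2) ev[OF i(1)]
        by (simp add: norm_eq_1)
    qed
    then have "{j \<in> {1..N}. inner p p \<le> inner p (ev j)} \<subseteq> {i}"
      by auto
    then have "card {j \<in> {1..N}. inner p p \<le> inner p (ev j)} \<le> card {i}"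
      by (rule card_mono[rotated]) simp
    then have "k \<le> 1"
      using half[of p] by simp
    then show False
      using assms i by auto
  next
    case False
    then have "0 \<notin> (\<lambda>j. ev j - p) ` {1..N}"
      by auto
    then obtain a where "\<forall>v\<in>(\<lambda>j. ev j - p) ` {1..N}. inner a v \<noteq> 0"
      using exists_direction_avoiding by blast
    then have a: "inner a (ev j - p) \<noteq> 0" if "j \<in> {1..N}" for j
      using that by blast
    let ?A = "{j \<in> {1..N}. inner a p \<le> inner a (ev j)}"
    let ?B = "{j \<in> {1..N}. inner (- a) p \<le> inner (- a) (ev j)}"
    \<comment> \<open>No eigenvalue lies on the line through \<open>p\<close> normal to
      \<open>a\<close>, so the two closed sides share none, yet each contains at least
      \<open>k\<close>.\<close>
    have "?A \<inter> ?B = {}"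
      using a by (fastforce simp: inner_diff_right)
    then have "card ?A + card ?B = card (?A \<union> ?B)"
      by (simp add: card_Un_disjoint)
    also have "\<dots> \<le> card {1..N}"
      by (rule card_mono) auto
    finally show False
      using half[of a] half[of "- a"] \<open>N < 2 * k\<close> by simp
  qed
qed

lemma Omega_nonempty_if_ge:
  assumes "k \<ge> 1" "N \<ge> 3 * k - 2"
  shows "Omega_of_listing N k ev \<noteq> {}"
proof -
  define I where "I = {S. S \<subseteq> {1..N} \<and> card S = N + 1 - k}"
  define F where "F = (\<lambda>S. convex hull (ev ` S)) ` I"
  have three: "\<Inter>t \<noteq> {}" if t: "t \<subseteq> F" "card t \<le> 3" for t
  proof -
    \<comment> \<open>Different index sets may have equal hulls; picking one per hull keeps
      \<open>card T = card t\<close>.\<close>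
    obtain T where T: "T \<subseteq> I" "inj_on (\<lambda>S. convex hull (ev ` S)) T"
        "t = (\<lambda>S. convex hull (ev ` S)) ` T"
      using t(1) unfolding F_def by (auto simp: subset_image_inj)
    have "card ({1..N} - S) \<le> k - 1" if "S \<in> T" for S
      using that T(1) by (subst card_Diff_subset) (auto simp: I_def intro: finite_subset)
    then have "(\<Sum>S\<in>T. card ({1..N} - S)) \<le> card T * (k - 1)"
      using sum_bounded_above[of T "\<lambda>S. card ({1..N} - S)" "k - 1"] by simp
    also have "\<dots> \<le> 3 * (k - 1)"
      using t(2) T(2,3) by (simp add: card_image)
    also have "\<dots> < N"
      using assms by auto
    finally have "card (\<Union>S\<in>T. {1..N} - S) < card {1..N}"
      using card_UN_le[of T "\<lambda>S. {1..N} - S"] T(1) finite_subset[of T I]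
      by (auto simp: I_def)
    then have "\<not> {1..N} \<subseteq> (\<Union>S\<in>T. {1..N} - S)"
      using card_mono[of "\<Union>S\<in>T. {1..N} - S" "{1..N}"] T(1) finite_subset[of T I]
      by (auto simp: I_def)
    then obtain j where "\<And>S. S \<in> T \<Longrightarrow> j \<in> S"
      by blast
    then have "ev j \<in> \<Inter>t"
      unfolding T(3) by (auto intro: hull_inc)
    then show ?thesis
      by blast
  qed
  have "\<Inter>F \<noteq> {}"
  \<comment> \<open>Helly's theorem asks for at least three sets; a family of at most three is
    covered by \<open>three\<close> itself.\<close>
  proof (cases "card F \<le> 3")
    case False
    show ?thesis
    proof (rule Helly)
      show "DIM(complex) + 1 \<le> card F"
        using False by simp
      show "\<forall>s\<in>F. convex s"
        by (auto simp: F_def)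
      show "\<Inter>t \<noteq> {}" if "t \<subseteq> F" "card t = DIM(complex) + 1" for t
        using three that by simp
    qed
  qed (rule three, simp)
  then show ?thesis
    by (simp add: Omega_of_listing_def F_def I_def)
qed

section \<open>Chords of the unit circle\<close>

lemma cis_eq_imp_eq:
  assumes "cis a = cis b" "\<bar>a - b\<bar> < 2 * pi"
  shows "a = b"
proof -
  have "cis (a - b) = 1"
    using assms(1) by (simp flip: cis_divide)
  then have "cos (a - b) = 1"
    by (simp add: complex_eq_iff)
  then obtain n :: int where n: "a - b = of_int n * 2 * pi"
    by (auto simp: cos_one_2pi_int)
  then have "\<bar>real_of_int n\<bar> < 1"
    using assms(2) by (simp add: abs_mult)
  then have "n = 0"
    by linarith
  then show ?thesis
    using n by simp
qed

lemma inner_cis: "inner (cis a) (cis b) = cos (b - a)"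
  by (simp add: inner_complex_def cos_diff)

lemma cos_gt_if_abs_less:
  fixes x h :: real
  assumes "\<bar>x\<bar> < h" "h \<le> pi"
  shows "cos h < cos x"
  using cos_monotone_0_pi[of "\<bar>x\<bar>" h] assms by simp

lemma cos_less_if_abs_greater:
  fixes x h :: real
  assumes "h < \<bar>x\<bar>" "\<bar>x\<bar> < 2 * pi - h" "0 \<le> h"
  shows "cos x < cos h"
proof (cases "\<bar>x\<bar> \<le> pi")
  case True
  then show ?thesis
    using cos_monotone_0_pi[of h "\<bar>x\<bar>"] assms by simp
next
  case False
  \<comment> \<open>Reflection moves the angle into the interval from \<open>h\<close> to
    \<open>pi\<close>, where cosine decreases.\<close>
  then have "cos (2 * pi - \<bar>x\<bar>) < cos h"
    using cos_monotone_0_pi[of h "2 * pi - \<bar>x\<bar>"] assms by simp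
  then show ?thesis
    by (simp add: cos_diff)
qed

text \<open>After rotation by \<open>- m\<close> the line becomes the vertical line
  \<open>Re q = cos h\<close>, and the unit disc leaves only the part with
  \<open>\<bar>Im q\<bar> \<le> sin h\<close>, which is the chord.\<close>

lemma mem_chord:
  assumes "norm p \<le> 1" "inner (cis m) p = cos h" "0 < h" "h < pi"
  shows "p \<in> closed_segment (cis (m - h)) (cis (m + h))"
proof -
  define q where "q = p * cis (- m)"
  have pq: "p = q * cis m"
    by (simp add: q_def mult.assoc cis_mult)
  have re: "Re q = cos h"
    using assms(2) by (simp add: q_def inner_complex_def algebra_simps)
  have s: "sin h > 0"
    using assms by (simp add: sin_gt_zero)
  have "norm q \<le> 1"
    using assms(1) by (simp add: q_def norm_mult)
  then have "(Re q)\<^sup>2 + (Im q)\<^sup>2 \<le> 1"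
    by (simp add: cmod_def)
  then have "(Im q)\<^sup>2 \<le> (sin h)\<^sup>2"
    using re by (simp add: sin_squared_eq)
  then have im: "\<bar>Im q\<bar> \<le> sin h"
    using s by (simp add: abs_le_square_iff[symmetric])
  define u where "u = (1 + Im q / sin h) / 2"
  have u: "0 \<le> u" "u \<le> 1"
    using im s by (auto simp: u_def field_simps)
  have "q = (1 - u) *\<^sub>R cis (- h) + u *\<^sub>R cis h"
    using s re by (auto simp: complex_eq_iff u_def field_simps)
  then have "p = ((1 - u) *\<^sub>R cis (- h) + u *\<^sub>R cis h) * cis m"
    unfolding pq by simp
  also have "\<dots> = (1 - u) *\<^sub>R (cis (- h) * cis m) + u *\<^sub>R (cis h * cis m)"
    by (simp add: algebra_simps)
  also have "\<dots> = (1 - u) *\<^sub>R cis (m - h) + u *\<^sub>R cis (m + h)"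
    by (simp add: cis_mult add.commute)
  finally show ?thesis
    using u by (auto simp: in_segment)
qed

section \<open>The case \<open>N = 2 k\<close>: the chords from \<open>ev j\<close> to
  \<open>ev (j + k)\<close>\<close>

locale circle_points =
  fixes k :: nat and ev :: "nat \<Rightarrow> complex" and \<theta> :: "nat \<Rightarrow> real"
  assumes k_pos: "k \<ge> 1"
    and ev_cis: "j \<in> {1..2 * k} \<Longrightarrow> ev j = cis (\<theta> j)"
    and strict: "strict_mono_on {1..2 * k} \<theta>"
    and turn: "\<theta> (2 * k) < \<theta> 1 + 2 * pi"
begin

text \<open>Chord \<open>j\<close> lies on the line
  \<open>inner (cis (mid j)) z = cos (hlf j)\<close>. Taking \<open>j\<close> in
  \<open>{1..k}\<close> keeps \<open>j + k\<close> within the listing, without cyclic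
  indices.\<close>

definition mid where "mid j = (\<theta> j + \<theta> (j + k)) / 2"
definition hlf where "hlf j = (\<theta> (j + k) - \<theta> j) / 2"

lemma theta_less: "i \<in> {1..2 * k} \<Longrightarrow> j \<in> {1..2 * k} \<Longrightarrow> i < j \<Longrightarrow> \<theta> i < \<theta> j"
  using strict by (auto simp: strict_mono_on_def)

lemma theta_le: "i \<in> {1..2 * k} \<Longrightarrow> j \<in> {1..2 * k} \<Longrightarrow> i \<le> j \<Longrightarrow> \<theta> i \<le> \<theta> j"
  using theta_less[of i j] by (cases "i = j") auto

lemma theta_turn: "i \<in> {1..2 * k} \<Longrightarrow> j \<in> {1..2 * k} \<Longrightarrow> \<theta> i < \<theta> j + 2 * pi"
  using theta_le[of i "2 * k"] theta_le[of 1 j] turn k_pos by auto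

lemma hlf_bounds: "j \<in> {1..k} \<Longrightarrow> 0 < hlf j" "j \<in> {1..k} \<Longrightarrow> hlf j < pi"
  using theta_less[of j "j + k"] theta_turn[of "j + k" j] k_pos by (auto simp: hlf_def)

lemma chord_ends:
  assumes "j \<in> {1..k}"
  shows "ev j = cis (mid j - hlf j)" "ev (j + k) = cis (mid j + hlf j)"
  using ev_cis[of j] ev_cis[of "j + k"] assms by (auto simp: mid_def hlf_def field_simps)

lemma inside_chord:
  assumes j: "j \<in> {1..k}" and i: "j < i" "i < j + k"
  shows "cos (hlf j) < inner (cis (mid j)) (ev i)"
proof -
  have "\<theta> j < \<theta> i" "\<theta> i < \<theta> (j + k)"
    using assms by (auto intro!: theta_less)
  then have "\<bar>\<theta> i - mid j\<bar> < hlf j"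
    by (auto simp: mid_def hlf_def abs_less_iff field_simps)
  then have "cos (hlf j) < cos (\<theta> i - mid j)"
    using hlf_bounds[OF j] by (intro cos_gt_if_abs_less) auto
  then show ?thesis
    using ev_cis[of i] assms by (simp add: inner_cis)
qed

text \<open>The angle of \<open>ev i\<close> is off \<open>mid j\<close> by more than
  \<open>hlf j\<close>; since all angles fit within one turn, it is also off by less than
  \<open>2 * pi - hlf j\<close>, so it does not come round to the chord's arc again.\<close>

lemma outside_chord:
  assumes j: "j \<in> {1..k}" and i: "i \<in> {1..2 * k}" "i < j \<or> j + k < i"
  shows "inner (cis (mid j)) (ev i) < cos (hlf j)"
proof -
  have "\<theta> i < \<theta> j \<or> \<theta> (j + k) < \<theta> i"
    using assms theta_less[of i j] theta_less[of "j + k" i] by auto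
  moreover have "\<theta> i < \<theta> j + 2 * pi" "\<theta> (j + k) < \<theta> i + 2 * pi" "\<theta> j < \<theta> (j + k)"
    using assms theta_turn[of i j] theta_turn[of "j + k" i] theta_less[of j "j + k"] k_pos by auto
  ultimately have "hlf j < \<bar>\<theta> i - mid j\<bar>" "\<bar>\<theta> i - mid j\<bar> < 2 * pi - hlf j"
    by (auto simp: mid_def hlf_def abs_if field_simps)
  then have "cos (\<theta> i - mid j) < cos (hlf j)"
    using hlf_bounds[OF j] by (intro cos_less_if_abs_greater) auto
  then show ?thesis
    using ev_cis[of i] assms by (simp add: inner_cis)
qed

lemma on_chord:
  assumes "j \<in> {1..k}"
  shows "inner (cis (mid j)) (ev j) = cos (hlf j)" "inner (cis (mid j)) (ev (j + k)) = cos (hlf j)"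
  using chord_ends[OF assms] by (simp_all add: inner_cis)

text \<open>The two closed arcs cut off by the chord have \<open>k + 1\<close> points each and lie on opposite
  sides of the chord.\<close>

lemma Omega_subset_chord:
  assumes j: "j \<in> {1..k}" and p: "p \<in> Omega_of_listing (2 * k) k ev"
  shows "p \<in> closed_segment (ev j) (ev (j + k))"
proof -
  let ?S = "{j..j + k}" and ?T = "{1..j} \<union> {j + k..2 * k}"
  have S: "?S \<subseteq> {1..2 * k}" and T: "?T \<subseteq> {1..2 * k}"
    using j by auto
  have "card ?T = card {1..j} + card {j + k..2 * k}"
    using j k_pos by (intro card_Un_disjoint) auto
  then have "card ?T = k + 1"
    using j by simp
  then have pS: "p \<in> convex hull (ev ` ?S)" and pT: "p \<in> convex hull (ev ` ?T)"
    using Omega_of_listing_mono[OF p S] Omega_of_listing_mono[OF p T] by simp_all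
  have "convex hull (ev ` ?S) \<subseteq> {z. inner (cis (mid j)) z \<ge> cos (hlf j)}"
  proof (rule hull_minimal)
    have "cos (hlf j) \<le> inner (cis (mid j)) (ev i)" if "i \<in> ?S" for i
      using that inside_chord[OF j, of i] on_chord[OF j]
      by (cases "i = j \<or> i = j + k") (auto intro: less_imp_le)
    then show "ev ` ?S \<subseteq> {z. inner (cis (mid j)) z \<ge> cos (hlf j)}"
      by blast
  qed (rule convex_halfspace_ge)
  moreover have "convex hull (ev ` ?T) \<subseteq> {z. inner (cis (mid j)) z \<le> cos (hlf j)}"
  proof (rule hull_minimal)
    have "inner (cis (mid j)) (ev i) \<le> cos (hlf j)" if "i \<in> ?T" for i
      using that T outside_chord[OF j, of i] on_chord[OF j]
      by (cases "i = j \<or> i = j + k") (auto intro: less_imp_le)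
    then show "ev ` ?T \<subseteq> {z. inner (cis (mid j)) z \<le> cos (hlf j)}"
      by blast
  qed (rule convex_halfspace_le)
  ultimately have "inner (cis (mid j)) p = cos (hlf j)"
    using pS pT by force
  \<comment> \<open>The line extends beyond the chord; the unit disc cuts it down.\<close>
  moreover have "convex hull (ev ` ?S) \<subseteq> cball 0 1"
    using S by (intro hull_minimal) (auto simp: ev_cis)
  ultimately show ?thesis
    using pS chord_ends[OF j] hlf_bounds[OF j] mem_chord[of p "mid j" "hlf j"] by auto
qed

text \<open>The pairs \<open>j\<close>, \<open>j + k\<close> split the \<open>2 * k\<close> indices
  into \<open>k\<close> classes, so any \<open>k + 1\<close> indices contain a whole pair, and the
  hull contains its chord.\<close>

lemma Omega_eq_chords:
  "Omega_of_listing (2 * k) k ev = (\<Inter>j\<in>{1..k}. closed_segment (ev j) (ev (j + k)))"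
proof (intro equalityI subsetI INT_I)
  fix p assume p: "p \<in> (\<Inter>j\<in>{1..k}. closed_segment (ev j) (ev (j + k)))"
  show "p \<in> Omega_of_listing (2 * k) k ev"
    unfolding Omega_of_listing_def
  proof (rule INT_I)
    fix S assume S: "S \<in> {S. S \<subseteq> {1..2 * k} \<and> card S = 2 * k + 1 - k}"
    have "\<not> inj_on (\<lambda>i. if i \<le> k then i else i - k) S"
    proof (rule pigeonhole)
      have "card ((\<lambda>i. if i \<le> k then i else i - k) ` S) \<le> card {1..k}"
        using S by (intro card_mono image_subsetI) force+
      then show "card ((\<lambda>i. if i \<le> k then i else i - k) ` S) < card S"
        using S by simp
    qed
    then obtain x y where xy: "x \<in> S" "y \<in> S" "x < y"
        "(if x \<le> k then x else x - k) = (if y \<le> k then y else y - k)"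
      by (auto simp: inj_on_def) (metis linorder_neqE_nat)+
    then have "x \<in> {1..k}" "y = x + k"
      using S by (auto split: if_splits)
    then have "p \<in> convex hull {ev x, ev y}"
      using p by (auto simp: segment_convex_hull)
    also have "\<dots> \<subseteq> convex hull (ev ` S)"
      using xy by (intro hull_mono) auto
    finally show "p \<in> convex hull (ev ` S)" .
  qed
qed (rule Omega_subset_chord)

text \<open>Along the second chord, the affine function vanishing on the first one changes sign, so it
  has a single zero.\<close>

lemma chords_meet_once:
  assumes "k \<noteq> 1" "p \<in> (\<Inter>j\<in>{1..k}. closed_segment (ev j) (ev (j + k)))"
    "q \<in> (\<Inter>j\<in>{1..k}. closed_segment (ev j) (ev (j + k)))"
  shows "p = q"
proof -
  have k: "k \<ge> 2"
    using assms(1) k_pos by simp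
  define f where "f z = inner (cis (mid 1)) z - cos (hlf 1)" for z
  have pos: "f (ev 2) > 0" and neg: "f (ev (2 + k)) < 0"
    using inside_chord[of 1 2] outside_chord[of 1 "2 + k"] k by (auto simp: f_def)
  have zero: "f z = 0" if z: "z \<in> closed_segment (ev 1) (ev (1 + k))" for z
  proof -
    obtain t where t: "z = (1 - t) *\<^sub>R ev 1 + t *\<^sub>R ev (1 + k)"
      using z unfolding in_segment by blast
    show ?thesis
      unfolding f_def t using on_chord[of 1] k by (simp add: inner_add_right algebra_simps)
  qed
  \<comment> \<open>The value of \<open>s\<close> does not depend on \<open>z\<close>, so two common
    points coincide.\<close>
  have param: "\<exists>s. z = (1 - s) *\<^sub>R ev 2 + s *\<^sub>R ev (2 + k) \<and> s = f (ev 2) / (f (ev 2) - f (ev (2 + k)))"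
    if z: "z \<in> (\<Inter>j\<in>{1..k}. closed_segment (ev j) (ev (j + k)))" for z
  proof -
    have "z \<in> closed_segment (ev 2) (ev (2 + k))" "f z = 0"
      using INT_D[OF z, of 1] INT_D[OF z, of 2] k zero[of z] by auto
    then obtain s where s: "z = (1 - s) *\<^sub>R ev 2 + s *\<^sub>R ev (2 + k)" "f z = 0"
      by (auto simp: in_segment)
    have "(1 - s) * f (ev 2) + s * f (ev (2 + k)) = 0"
      using s(2) unfolding s(1) f_def
      by (simp add: inner_add_right algebra_simps)
    then have "s * (f (ev 2) - f (ev (2 + k))) = f (ev 2)"
      by (simp add: algebra_simps)
    then show ?thesis
      using s pos neg by (auto simp: field_simps)
  qed
  show ?thesis
    using param[OF assms(2)] param[OF assms(3)] by auto
qed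

end

section \<open>Examples in the range between \<open>2k\<close> and \<open>3k - 2\<close>\<close>

text \<open>All but at most one of the points form \<open>m\<close> antipodal pairs. The case \<open>j > m\<close> skips the
  angle \<open>\<pi>\<close>, which is antipodal to the leftover point at angle \<open>2 \<pi>\<close>.\<close>

lemma exists_listing_Omega_nonempty:
  assumes "2 * k < N"
  shows "\<exists>ev. (\<forall>j. norm (ev j) = 1) \<and> inj_on ev {1..N} \<and> Omega_of_listing N k ev \<noteq> {}"
proof -
  define m where "m = N div 2"
  define c where "c j = (if j \<le> m then j else j + 1)" for j
  define \<theta> where "\<theta> j = pi * (real (c j) / real (m + 1))" for j
  define ev where "ev j = cis (\<theta> j)" for j
  have m: "2 * m \<le> N" "N \<le> 2 * m + 1" "k \<le> m"
    using assms by (auto simp: m_def)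
  have range: "0 < \<theta> j \<and> \<theta> j \<le> 2 * pi" if "j \<in> {1..N}" for j
  proof -
    have "0 < real (c j)" "real (c j) \<le> 2 * real (m + 1)"
      using that m by (auto simp: c_def)
    then have "0 < real (c j) / real (m + 1)" "real (c j) / real (m + 1) \<le> 2"
      by (auto simp: divide_le_eq)
    from mult_pos_pos[OF pi_gt_zero this(1)] mult_left_mono[OF this(2), of pi]
    show ?thesis
      by (simp add: \<theta>_def)
  qed
  have "inj_on ev {1..N}"
  proof (rule inj_onI)
    fix i j assume ij: "i \<in> {1..N}" "j \<in> {1..N}" "ev i = ev j"
    have "\<bar>\<theta> i - \<theta> j\<bar> < 2 * pi"
      using range[OF ij(1)] range[OF ij(2)] by auto
    then have "\<theta> i = \<theta> j"
      using ij(3) cis_eq_imp_eq by (auto simp: ev_def)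
    then have "c i = c j"
      by (simp add: \<theta>_def)
    then show "i = j"
      by (auto simp: c_def split: if_splits)
  qed
  moreover have "0 \<in> Omega_of_listing N k ev"
    unfolding Omega_of_listing_def
  proof (rule INT_I)
    fix S assume S: "S \<in> {S. S \<subseteq> {1..N} \<and> card S = N + 1 - k}"
    define T where "T = S \<inter> {1..2 * m}"
    have "card S \<le> card (T \<union> {2 * m + 1..N})"
      using S by (intro card_mono) (auto simp: T_def)
    also have "\<dots> \<le> card T + card {2 * m + 1..N}"
      by (rule card_Un_le)
    \<comment> \<open>At most \<open>N - 2 * m\<close> indices are lost from
      \<open>N + 1 - k\<close>, leaving at least \<open>2 * m + 1 - k\<close>, and
      \<open>k \<le> m\<close>.\<close>
    finally have cT: "m < card T"
      using S m by simp
    have "\<not> inj_on (\<lambda>i. if i \<le> m then i else i - m) T"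
    proof (rule pigeonhole)
      have "card ((\<lambda>i. if i \<le> m then i else i - m) ` T) \<le> card {1..m}"
        by (intro card_mono) (auto simp: T_def)
      then show "card ((\<lambda>i. if i \<le> m then i else i - m) ` T) < card T"
        using cT by simp
    qed
    then obtain x y where xy: "x \<in> T" "y \<in> T" "x < y"
        "(if x \<le> m then x else x - m) = (if y \<le> m then y else y - m)"
      by (auto simp: inj_on_def) (metis linorder_neqE_nat)+
    then have "x \<in> {1..m}" "y = x + m"
      by (auto simp: T_def split: if_splits)
    \<comment> \<open>Here \<open>c y = c x + (m + 1)\<close>, and \<open>m + 1\<close> steps make
      the angle \<open>pi\<close>.\<close>
    then have "\<theta> y = \<theta> x + pi"
      by (auto simp: \<theta>_def c_def field_simps)
    then have "ev y = - ev x"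
      by (simp add: ev_def complex_eq_iff)
    then have "0 \<in> closed_segment (ev x) (ev y)"
      by (auto simp: in_segment intro!: exI[of _ "1/2"])
    also have "\<dots> = convex hull {ev x, ev y}"
      by (rule segment_convex_hull)
    also have "\<dots> \<subseteq> convex hull (ev ` S)"
      using xy by (intro hull_mono) (auto simp: T_def)
    finally show "0 \<in> convex hull (ev ` S)" .
  qed
  ultimately show ?thesis
    by (intro exI[of _ ev]) (auto simp: ev_def)
qed

text \<open>Three clusters of at most \<open>k - 1\<close> points close to the cube roots of unity \<open>u 0, u 1, u 2\<close>:
  a point of \<open>Omega\<close> is in the hull of any two clusters, hence has negative inner product with
  each \<open>u i\<close>, although the \<open>u i\<close> sum to 0.\<close>

lemma exists_listing_Omega_empty:
  assumes "k \<ge> 1" "N < 3 * k - 2"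
  shows "\<exists>ev. (\<forall>j. norm (ev j) = 1) \<and> inj_on ev {1..N} \<and> Omega_of_listing N k ev = {}"
proof -
  \<comment> \<open>The first two clusters have \<open>k - 1\<close> indices each when
    \<open>N\<close> is large enough; the third starts at \<open>2 * k - 1\<close> and has at most
    \<open>k - 1\<close>, as \<open>N \<le> 3 * k - 3\<close>.\<close>
  define c where "c j = (if j < k then 0 else if j < 2 * k - 1 then 1 else 2 :: nat)" for j
  \<comment> \<open>The bound \<open>pi / 6\<close> keeps points of other clusters more than a right
    angle away from \<open>u i\<close>: \<open>2 * pi / 3 - pi / 6 = pi / 2\<close> and
    \<open>4 * pi / 3 + pi / 6 = 3 * pi / 2\<close>.\<close>
  define e where "e j = pi / 6 * (real j / real (N + 1))" for j
  define \<theta> where "\<theta> j = 2 * pi / 3 * real (c j) + e j" for j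
  define ev where "ev j = cis (\<theta> j)" for j
  define u where "u i = cis (2 * pi / 3 * real i)" for i :: nat
  have c_cases: "c j = 0 \<or> c j = 1 \<or> c j = 2" for j
    by (auto simp: c_def)
  have e_range: "0 < e j" "e j < pi / 6" if "j \<in> {1..N}" for j
  proof -
    have "0 < real j / real (N + 1)" "real j / real (N + 1) < 1"
      using that by (auto simp: divide_simps)
    from mult_pos_pos[OF _ this(1), of "pi / 6"] mult_strict_left_mono[OF this(2), of "pi / 6"]
    show "0 < e j" "e j < pi / 6"
      by (simp_all add: e_def)
  qed
  have "inj_on ev {1..N}"
  proof (rule inj_onI)
    fix i j assume ij: "i \<in> {1..N}" "j \<in> {1..N}" "ev i = ev j"
    note r = e_range[OF ij(1)] e_range[OF ij(2)]
    have "\<bar>\<theta> i - \<theta> j\<bar> < 2 * pi"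
      using r c_cases[of i] c_cases[of j] by (auto simp: \<theta>_def)
    then have eq: "\<theta> i = \<theta> j"
      using ij(3) cis_eq_imp_eq by (auto simp: ev_def)
    then have "c i = c j"
      using r c_cases[of i] c_cases[of j] by (auto simp: \<theta>_def)
    then have "e i = e j"
      using eq by (simp add: \<theta>_def)
    then show "i = j"
      by (simp add: e_def)
  qed
  moreover have "Omega_of_listing N k ev = {}"
  proof (rule ccontr)
    assume "Omega_of_listing N k ev \<noteq> {}"
    then obtain p where p: "p \<in> Omega_of_listing N k ev"
      by blast
    have neg: "inner (u i) p < 0" if i: "i < 3" for i
    proof -
      have "{j \<in> {1..N}. c j = 0} \<subseteq> {1..<k}" "{j \<in> {1..N}. c j = 1} \<subseteq> {k..<2 * k - 1}"
          "{j \<in> {1..N}. c j = 2} \<subseteq> {2 * k - 1..N}"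
        by (auto simp: c_def split: if_splits)
      from this[THEN card_mono[rotated]]
      have "card {j \<in> {1..N}. c j = i} \<le> k - 1"
        using i assms by (auto simp: less_Suc_eq numeral_3_eq_3 numeral_2_eq_2)
      then have "N + 1 - k \<le> card ({1..N} - {j \<in> {1..N}. c j = i})"
        using assms by (subst card_Diff_subset) auto
      then have "p \<in> convex hull (ev ` ({1..N} - {j \<in> {1..N}. c j = i}))"
        by (intro Omega_of_listing_mono[OF p]) auto
      also have "\<dots> \<subseteq> {z. inner (u i) z < 0}"
      proof (rule hull_minimal)
        have "inner (u i) (ev j) < 0" if j: "j \<in> {1..N}" "c j \<noteq> i" for j
        proof -
          have "pi / 2 < \<bar>\<theta> j - 2 * pi / 3 * real i\<bar>"
              "\<bar>\<theta> j - 2 * pi / 3 * real i\<bar> < 2 * pi - pi / 2"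
            using e_range[OF j(1)] c_cases[of j] i j(2)
            by (auto simp: \<theta>_def less_Suc_eq numeral_3_eq_3)
          then have "cos (\<theta> j - 2 * pi / 3 * real i) < cos (pi / 2)"
            by (intro cos_less_if_abs_greater) auto
          then show ?thesis
            by (simp add: u_def ev_def inner_cis)
        qed
        then show "ev ` ({1..N} - {j \<in> {1..N}. c j = i}) \<subseteq> {z. inner (u i) z < 0}"
          by blast
      qed (rule convex_halfspace_lt)
      finally show ?thesis
        by simp
    qed
    have "u 0 = 1" "u 1 = cis (pi - pi / 3)" "u 2 = cis (pi + pi / 3)"
      by (auto simp: u_def intro!: arg_cong[of _ _ cis])
    moreover have "1 + cis (pi - pi / 3) + cis (pi + pi / 3) = 0"
      unfolding complex_eq_iff plus_complex.sel cis.sel one_complex.sel zero_complex.sel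
        cos_add sin_add cos_diff sin_diff cos_60 sin_60 by simp
    ultimately have "u 0 + u 1 + u 2 = 0"
      by simp
    then have "inner (u 0) p + inner (u 1) p + inner (u 2) p = 0"
      by (metis inner_add_left inner_zero_left)
    then show False
      using neg[of 0] neg[of 1] neg[of 2] by simp
  qed
  ultimately show ?thesis
    by (intro exI[of _ ev]) (auto simp: ev_def)
qed

section \<open>Results for unitary matrices\<close>

lemma Omega_unitary_2k:
  assumes U: "U \<in> carrier_mat N N" "card (spectrum U) = N" and N: "N = 2 * k" and k: "k \<ge> 1"
    and ev: "eigenvalue_listing U ev" "counterclockwise N ev" and per: "\<forall>j. ev (j + N) = ev j"
  shows "Omega k U = (\<Inter>j\<in>{1..N}. closed_segment (ev j) (ev (j + k)))"
    and "\<lbrakk>k \<noteq> 1; p \<in> (\<Inter>j\<in>{1..N}. closed_segment (ev j) (ev (j + k)))\<rbrakk> \<Longrightarrow> Omega k U = {p}"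
proof -
  obtain \<theta> where \<theta>: "\<And>j. j \<in> {1..N} \<Longrightarrow> ev j = cis (\<theta> j)" "mono_on {1..N} \<theta>" "\<theta> N < \<theta> 1 + 2 * pi"
    using ev(2) by (auto simp: counterclockwise_def)
  have "inj_on ev {1..N}"
    using eigenvalue_listing_inj_on U ev(1) by blast
  \<comment> \<open>Distinct eigenvalues turn the weak monotonicity of the angles into strict
    monotonicity.\<close>
  then have "\<theta> i \<noteq> \<theta> j" if "i \<in> {1..N}" "j \<in> {1..N}" "i < j" for i j
    using \<theta>(1)[OF that(1)] \<theta>(1)[OF that(2)] inj_onD[of ev "{1..N}" i j] that by auto
  then have "strict_mono_on {1..N} \<theta>"
    using mono_onD[OF \<theta>(2)] by (intro strict_mono_onI order.not_eq_order_implies_strict) auto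
  then interpret circle_points k ev \<theta>
    using \<theta> N k by unfold_locales auto
  \<comment> \<open>By periodicity, the indices above \<open>k\<close> repeat the first
    \<open>k\<close> chords with the ends swapped.\<close>
  have seg: "closed_segment (ev j) (ev (j + k)) = closed_segment (ev (j - k)) (ev (j - k + k))"
    if "j \<in> {k + 1..N}" for j
  proof -
    have "ev (j + k) = ev (j - k)"
      using per[rule_format, of "j - k"] that N by (simp add: add.commute)
    then show ?thesis
      using that by (simp add: closed_segment_commute)
  qed
  have eq: "(\<Inter>j\<in>{1..N}. closed_segment (ev j) (ev (j + k))) = (\<Inter>j\<in>{1..k}. closed_segment (ev j) (ev (j + k)))"
  proof (rule antisym)
    show "(\<Inter>j\<in>{1..k}. closed_segment (ev j) (ev (j + k))) \<subseteq> (\<Inter>j\<in>{1..N}. closed_segment (ev j) (ev (j + k)))"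
    proof (intro subsetI INT_I)
      fix z j assume z: "z \<in> (\<Inter>j\<in>{1..k}. closed_segment (ev j) (ev (j + k)))" and j: "j \<in> {1..N}"
      show "z \<in> closed_segment (ev j) (ev (j + k))"
      proof (cases "j \<le> k")
        case False
        then have "j \<in> {k + 1..N}" "j - k \<in> {1..k}"
          using j N by auto
        then show ?thesis
          using z seg by blast
      qed (use z j in auto)
    qed
  qed (use N in auto)
  then show Om: "Omega k U = (\<Inter>j\<in>{1..N}. closed_segment (ev j) (ev (j + k)))"
    using Omega_eq[OF U(1) ev(1)] Omega_eq_chords N by simp
  assume "k \<noteq> 1" "p \<in> (\<Inter>j\<in>{1..N}. closed_segment (ev j) (ev (j + k)))"
  then show "Omega k U = {p}"
    unfolding Om eq using chords_meet_once by blast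
qed

text \<open>For \<open>k = 1\<close> the set is the hull of all eigenvalues: a point if
  \<open>N = 1\<close>, a whole segment if \<open>N = 2\<close> and they are distinct. Hence the
  exclusions in parts (1) and (2). Part (3) is stated as the existence of matrices of both kinds for
  all \<open>N\<close> and \<open>k\<close> in the range.\<close>

theorem theorem4p7:
  fixes N k :: nat
  assumes k: "k \<ge> 1"
  shows
    "(\<forall>U \<in> carrier_mat N N. unitary_mat U \<longrightarrow> card (spectrum U) = N \<longrightarrow>
        N < 2 * k \<longrightarrow> \<not> (N = 1 \<and> k = 1) \<longrightarrow> Omega k U = {})
     \<and>
     (\<forall>U \<in> carrier_mat N N. unitary_mat U \<longrightarrow> card (spectrum U) = N \<longrightarrow> N = 2 * k \<longrightarrow>
        (\<forall>ev. eigenvalue_listing U ev \<longrightarrow> counterclockwise N ev \<longrightarrow> (\<forall>j. ev (j + N) = ev j) \<longrightarrow>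
           ((\<Inter>j\<in>{1..N}. closed_segment (ev j) (ev (j + k))) = {} \<longrightarrow> Omega k U = {}) \<and>
           (\<forall>p \<in> (\<Inter>j\<in>{1..N}. closed_segment (ev j) (ev (j + k))). k \<noteq> 1 \<longrightarrow> Omega k U = {p})))
     \<and>
     (2 * k < N \<and> N < 3 * k - 2 \<longrightarrow>
        (\<exists>U \<in> carrier_mat N N. unitary_mat U \<and> card (spectrum U) = N \<and> Omega k U = {}) \<and>
        (\<exists>U \<in> carrier_mat N N. unitary_mat U \<and> card (spectrum U) = N \<and> Omega k U \<noteq> {}))
     \<and>
     (\<forall>U \<in> carrier_mat N N. unitary_mat U \<longrightarrow> N \<ge> 3 * k - 2 \<longrightarrow> Omega k U \<noteq> {})"
proof (intro conjI ballI allI impI; (elim conjE)?)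
  fix U :: "complex mat"
  assume U: "U \<in> carrier_mat N N" "unitary_mat U" "card (spectrum U) = N"
    and N: "N < 2 * k" "\<not> (N = 1 \<and> k = 1)"
  obtain ev where ev: "eigenvalue_listing U ev"
    using eigenvalue_listing_exists[OF U(1)] by blast
  show "Omega k U = {}"
    unfolding Omega_eq[OF U(1) ev]
    using eigenvalue_listing_norm[OF U(1,2) ev] eigenvalue_listing_inj_on[OF U(1) ev U(3)] k N
    by (intro Omega_empty_if_lt_2k)
next
  fix U :: "complex mat" and ev
  assume "U \<in> carrier_mat N N" "card (spectrum U) = N" "N = 2 * k"
    "eigenvalue_listing U ev" "counterclockwise N ev" "\<forall>j. ev (j + N) = ev j"
    "(\<Inter>j\<in>{1..N}. closed_segment (ev j) (ev (j + k))) = {}"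
  then show "Omega k U = {}"
    using Omega_unitary_2k(1) k by blast
next
  fix U :: "complex mat" and ev p
  assume "U \<in> carrier_mat N N" "card (spectrum U) = N" "N = 2 * k"
    "eigenvalue_listing U ev" "counterclockwise N ev" "\<forall>j. ev (j + N) = ev j"
    "p \<in> (\<Inter>j\<in>{1..N}. closed_segment (ev j) (ev (j + k)))" "k \<noteq> 1"
  then show "Omega k U = {p}"
    using Omega_unitary_2k(2) k by blast
next
  assume "N < 3 * k - 2"
  then obtain ev where "\<forall>j. norm (ev j) = 1" "inj_on ev {1..N}" "Omega_of_listing N k ev = {}"
    using exists_listing_Omega_empty k by blast
  then show "\<exists>U \<in> carrier_mat N N. unitary_mat U \<and> card (spectrum U) = N \<and> Omega k U = {}"
    using unitary_with_listing[of N ev k] by auto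
next
  assume "2 * k < N"
  then obtain ev where "\<forall>j. norm (ev j) = 1" "inj_on ev {1..N}" "Omega_of_listing N k ev \<noteq> {}"
    using exists_listing_Omega_nonempty by blast
  then show "\<exists>U \<in> carrier_mat N N. unitary_mat U \<and> card (spectrum U) = N \<and> Omega k U \<noteq> {}"
    using unitary_with_listing[of N ev k] by auto
next
  fix U :: "complex mat"
  assume U: "U \<in> carrier_mat N N" and N: "N \<ge> 3 * k - 2"
  obtain ev where "eigenvalue_listing U ev"
    using eigenvalue_listing_exists[OF U] by blast
  then show "Omega k U \<noteq> {}"
    using Omega_eq[OF U] Omega_nonempty_if_ge[OF k N] by simp
qed

end
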